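(* Let $A,B$ be quantum systems of finite dimensions $d_A,d_B$ with fully degenerate local Hamiltonians. Let $\mathrm{GLOCC}$ be the set of LOCC protocols $\Lambda$ on $AB$ (with classical communication allowed in both directions) satisfying $\Lambda[\mathbb{1}_{AB}/(d_Ad_B)]=\mathbb{1}_{AB}/(d_Ad_B)$, and for a quantum state $\rho^{AB}$ let $$F^{A|B}(\rho^{AB})=\max_{\Lambda\in\mathrm{GLOCC}}\langle 0|\mathrm{Tr}_A(\Lambda[\rho^{AB}])|0\rangle .$$ Then for every quantum state $\rho^{AB}$, $$F^{A|B}(\rho^{AB})\le\max_{X^{AB}}\mathrm{Tr}\left[X^{AB}\rho^{AB}\right],$$ where the maximum on the right is over all matrices $X^{AB}$ on $AB$ satisfying $$\mathbb{1}_{AB}\ge X^{AB}\ge 0,\qquad X^{T_B}\ge 0,\qquad \mathrm{Tr}[X^{AB}]=d_A .$$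
   Context: $|0\rangle$ is a fixed normalized state vector of $B$ (Bob's local ground state). $X^{T_B}$ denotes the partial transpose of $X^{AB}$ with respect to $B$. LOCC (local operations and classical communication) protocols are the completely positive trace-preserving maps on $AB$ (here with the same input and output space) realizable by sequences of local quantum operations of the two parties with classically communicated measurement outcomes. The maximum defining $F^{A|B}$ is understood as a supremum if it is not attained. *)

theory Defs
  imports "Jordan_Normal_Form.Schur_Decomposition"
begin

text \<open>
  Operators on a system of dimension \<open>d\<close> are complex \<open>d \<times> d\<close> matrices, state vectors are
  elements of \<open>carrier_vec d\<close>. Systems of dimension \<open>dA\<close> and \<open>dB\<close> are composed by identifying the
  product basis vector \<open>|a\<rangle> \<otimes> |b\<rangle>\<close> with the basis vector of index \<open>a * dB + b\<close>.
\<close>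

definition psd :: "nat \<Rightarrow> complex mat \<Rightarrow> bool" where
  \<comment> \<open>\<open>0 \<le> z\<close> on complex numbers means real and nonnegative, so hermiticity is implied.\<close>
  "psd d M \<longleftrightarrow> M \<in> carrier_mat d d \<and> (\<forall>v \<in> carrier_vec d. 0 \<le> (M *\<^sub>v v) \<bullet>c v)"

definition loewner_le :: "nat \<Rightarrow> complex mat \<Rightarrow> complex mat \<Rightarrow> bool" where
  "loewner_le d M N \<longleftrightarrow> M \<in> carrier_mat d d \<and> N \<in> carrier_mat d d \<and> psd d (N - M)"

definition tr :: "complex mat \<Rightarrow> complex" where
  "tr M = (\<Sum>i<dim_row M. M $$ (i, i))"

definition quantum_state :: "nat \<Rightarrow> complex mat \<Rightarrow> bool" where
  "quantum_state d \<rho> \<longleftrightarrow> psd d \<rho> \<and> tr \<rho> = 1"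

definition maximally_mixed :: "nat \<Rightarrow> complex mat" where
  "maximally_mixed d = (1 / of_nat d) \<cdot>\<^sub>m 1\<^sub>m d"

definition tensor_mat :: "complex mat \<Rightarrow> complex mat \<Rightarrow> complex mat" where
  "tensor_mat M N = mat (dim_row M * dim_row N) (dim_col M * dim_col N)
     (\<lambda>(i, j). M $$ (i div dim_row N, j div dim_col N) * N $$ (i mod dim_row N, j mod dim_col N))"

definition ptrace_A :: "nat \<Rightarrow> nat \<Rightarrow> complex mat \<Rightarrow> complex mat" where
  "ptrace_A dA dB M = mat dB dB (\<lambda>(b, b'). \<Sum>a<dA. M $$ (a * dB + b, a * dB + b'))"

definition ptranspose_B :: "nat \<Rightarrow> nat \<Rightarrow> complex mat \<Rightarrow> complex mat" where
  "ptranspose_B dA dB M = mat (dA * dB) (dA * dB)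
     (\<lambda>(i, j). M $$ ((i div dB) * dB + j mod dB, (j div dB) * dB + i mod dB))"

definition mat_sum :: "nat \<Rightarrow> complex mat list \<Rightarrow> complex mat" where
  "mat_sum d Ms = mat d d (\<lambda>ij. \<Sum>M\<leftarrow>Ms. M $$ ij)"

definition kraus_map :: "nat \<Rightarrow> complex mat list \<Rightarrow> complex mat \<Rightarrow> complex mat" where
  "kraus_map d Ks \<rho> = mat_sum d (map (\<lambda>K. K * \<rho> * mat_adjoint K) Ks)"

text \<open>
  A quantum instrument on a system of dimension \<open>d\<close> with outcomes \<open>0, \<dots>, n - 1\<close>: outcome \<open>i\<close> is
  accompanied by the completely positive map with Kraus operators \<open>Ks i\<close>, whose output system has
  dimension \<open>e i\<close>, and the sum of these maps is trace preserving. For \<open>n = 1\<close> this is a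
  deterministic quantum operation. Output dimensions are arbitrary, so ancillas and quantum
  memories are covered.
\<close>

definition instrument ::
  "nat \<Rightarrow> nat \<Rightarrow> (nat \<Rightarrow> nat) \<Rightarrow> (nat \<Rightarrow> complex mat list) \<Rightarrow> bool" where
  "instrument d n e Ks \<longleftrightarrow>
     (\<forall>i<n. \<forall>K \<in> set (Ks i). K \<in> carrier_mat (e i) d) \<and>
     mat_sum d (map (\<lambda>K. mat_adjoint K * K) (concat (map Ks [0..<n]))) = 1\<^sub>m d"

text \<open>
  \<open>locc cA cB dA dB \<Lambda>\<close>: the map \<open>\<Lambda>\<close> from operators on \<open>dA * dB\<close> to operators on \<open>cA * cB\<close> is
  realized by finitely many rounds, in each of which one of the parties applies a local instrument
  and announces the outcome \<open>i\<close>; the remaining protocol \<open>\<Lambda> i\<close> may depend on \<open>i\<close>. The record of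
  outcomes is discarded at the end.
\<close>

inductive locc ::
  "nat \<Rightarrow> nat \<Rightarrow> nat \<Rightarrow> nat \<Rightarrow> (complex mat \<Rightarrow> complex mat) \<Rightarrow> bool"
  for cA cB :: nat where
  stop: "locc cA cB cA cB (\<lambda>\<rho>. \<rho>)"
| alice: "instrument dA n e Ks \<Longrightarrow> (\<And>i. i < n \<Longrightarrow> locc cA cB (e i) dB (\<Lambda> i)) \<Longrightarrow>
    locc cA cB dA dB (\<lambda>\<rho>. mat_sum (cA * cB)
      (map (\<lambda>i. \<Lambda> i (kraus_map (e i * dB) (map (\<lambda>K. tensor_mat K (1\<^sub>m dB)) (Ks i)) \<rho>)) [0..<n]))"
| bob: "instrument dB n e Ks \<Longrightarrow> (\<And>i. i < n \<Longrightarrow> locc cA cB dA (e i) (\<Lambda> i)) \<Longrightarrow>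
    locc cA cB dA dB (\<lambda>\<rho>. mat_sum (cA * cB)
      (map (\<lambda>i. \<Lambda> i (kraus_map (dA * e i) (map (\<lambda>K. tensor_mat (1\<^sub>m dA) K) (Ks i)) \<rho>)) [0..<n]))"

text \<open>
  For fully degenerate local Hamiltonians the Gibbs state is maximally mixed at every temperature,
  and every normalized vector \<open>\<psi>\<close> of \<open>B\<close> is a ground state.
\<close>

definition GLOCC :: "nat \<Rightarrow> nat \<Rightarrow> (complex mat \<Rightarrow> complex mat) set" where
  "GLOCC dA dB = {\<Lambda>. locc dA dB dA dB \<Lambda> \<and>
     \<Lambda> (maximally_mixed (dA * dB)) = maximally_mixed (dA * dB)}"

definition F_AB :: "nat \<Rightarrow> nat \<Rightarrow> complex vec \<Rightarrow> complex mat \<Rightarrow> real" where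
  "F_AB dA dB \<psi> \<rho> = (SUP \<Lambda> \<in> GLOCC dA dB. Re ((ptrace_A dA dB (\<Lambda> \<rho>) *\<^sub>v \<psi>) \<bullet>c \<psi>))"

definition feasible :: "nat \<Rightarrow> nat \<Rightarrow> complex mat set" where
  "feasible dA dB = {X. loewner_le (dA * dB) (0\<^sub>m (dA * dB) (dA * dB)) X \<and>
     loewner_le (dA * dB) X (1\<^sub>m (dA * dB)) \<and>
     psd (dA * dB) (ptranspose_B dA dB X) \<and>
     tr X = of_nat dA}"

end

theory Submission
  imports "HOL-Analysis.Function_Topology" Defs
begin

text \<open>
  Pull the observable \<open>E = 1 \<otimes> |\<psi>\<rangle>\<langle>\<psi>|\<close> back through the protocol: in the Heisenberg picture a local
  round sends effects to effects, and positivity of the partial transpose is preserved since local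
  Kraus operators can be moved through the partial transpose. By induction on the protocol there is
  an effect \<open>X\<close> with \<open>X\<^sup>T\<^sup>B \<ge> 0\<close> and \<open>Tr[E \<Lambda>(\<rho>)] = Tr[X \<rho>]\<close> for all \<open>\<rho>\<close>. Evaluating this at the
  maximally mixed state, which \<open>\<Lambda>\<close> fixes, gives \<open>Tr X = Tr E = d\<^sub>A\<close>, so \<open>X\<close> is feasible. The maximum
  over feasible matrices is attained by compactness.
\<close>

section \<open>Tensor products and partial transposes\<close>

text \<open>The range splits into \<open>m\<close> consecutive blocks of length \<open>n\<close>.
  With the encoding \<open>a * dB + b\<close> of product basis vectors, this turns a sum over the
  composite index into a double sum over the indices of the two systems.\<close>

lemma sum_lessThan_mult:
  fixes f :: "nat \<Rightarrow> 'a :: comm_monoid_add"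
  shows "(\<Sum>i<m * n. f i) = (\<Sum>a<m. \<Sum>b<n. f (a * n + b))"
proof -
  have "sum f {a * n..<a * n + n} = (\<Sum>b<n. f (a * n + b))" for a
    using sum.shift_bounds_nat_ivl[of f 0 "a * n" n] by (simp add: lessThan_atLeast0 add.commute)
  then show ?thesis
    using sum.nat_group[of f n m] by simp
qed

text \<open>Partial transposition exchanges two Bob indices whose summations have an Alice summation
  between them, hence this exchange of the outer and the inner sum around a fixed middle
  one.\<close>

lemma sum_swap_outer:
  "(\<Sum>x\<in>A. \<Sum>y\<in>B. \<Sum>z\<in>C. f x y z) = (\<Sum>z\<in>C. \<Sum>y\<in>B. \<Sum>x\<in>A. f x y z)"
proof -
  have "(\<Sum>x\<in>A. \<Sum>y\<in>B. \<Sum>z\<in>C. f x y z) = (\<Sum>y\<in>B. \<Sum>x\<in>A. \<Sum>z\<in>C. f x y z)"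
    by (rule sum.swap)
  also have "\<dots> = (\<Sum>y\<in>B. \<Sum>z\<in>C. \<Sum>x\<in>A. f x y z)"
    by (rule sum.cong[OF refl sum.swap])
  also have "\<dots> = (\<Sum>z\<in>C. \<Sum>y\<in>B. \<Sum>x\<in>A. f x y z)"
    by (rule sum.swap)
  finally show ?thesis .
qed

lemma mult_add_less_mult: "a < m \<Longrightarrow> b < n \<Longrightarrow> a * n + b < m * (n :: nat)"
  by (metis add_less_cancel_left add.commute less_le_trans mult_Suc mult_le_mono1 Suc_leI)

lemma div_less_mult: "i < m * n \<Longrightarrow> i div n < (m :: nat)"
  by (simp add: less_mult_imp_div_less)

lemma mod_less_mult: "i < m * n \<Longrightarrow> i mod n < (n :: nat)"
  by (metis mod_less_divisor mult_0_right not_gr_zero not_less_zero)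

lemma mat_adjoint_dim [simp]:
  "dim_row (mat_adjoint A) = dim_col A" "dim_col (mat_adjoint A) = dim_row A"
  by (auto simp: mat_adjoint_def)

lemma mat_adjoint_carrier [simp]: "A \<in> carrier_mat m n \<Longrightarrow> mat_adjoint A \<in> carrier_mat n m"
  by (rule carrier_matI) simp_all

lemma mat_adjoint_index:
  "i < dim_col A \<Longrightarrow> j < dim_row A \<Longrightarrow> mat_adjoint A $$ (i, j) = conjugate (A $$ (j, i))"
  by (simp add: mat_adjoint_def mat_of_rows_index)

lemma tensor_mat_carrier [simp]:
  "A \<in> carrier_mat m n \<Longrightarrow> B \<in> carrier_mat p q \<Longrightarrow> tensor_mat A B \<in> carrier_mat (m * p) (n * q)"
  by (auto simp: tensor_mat_def)

lemma tensor_mat_index: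
  assumes "A \<in> carrier_mat m n" "B \<in> carrier_mat p q" "i < m * p" "j < n * q"
  shows "tensor_mat A B $$ (i, j) = A $$ (i div p, j div q) * B $$ (i mod p, j mod q)"
  using assms by (auto simp: tensor_mat_def)

lemma tensor_mat_one: "tensor_mat (1\<^sub>m m) (1\<^sub>m n) = 1\<^sub>m (m * n)"
proof (rule eq_matI)
  fix i j assume "i < dim_row (1\<^sub>m (m * n))" "j < dim_col (1\<^sub>m (m * n) :: complex mat)"
  then have ij: "i < m * n" "j < m * n" by auto
  note b = div_less_mult[OF ij(1)] div_less_mult[OF ij(2)] mod_less_mult[OF ij(1)] mod_less_mult[OF ij(2)]
  have "i div n = j div n \<Longrightarrow> i mod n = j mod n \<Longrightarrow> i = j"
    by (metis div_mult_mod_eq)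
  then show "tensor_mat (1\<^sub>m m) (1\<^sub>m n) $$ (i, j) = 1\<^sub>m (m * n) $$ (i, j)"
    unfolding tensor_mat_index[OF one_carrier_mat one_carrier_mat ij] index_one_mat(1)[OF ij]
      index_one_mat(1)[OF b(1,2)] index_one_mat(1)[OF b(3,4)]
    by auto
qed (auto simp: tensor_mat_def)

lemma mat_mult_index_sum:
  assumes "A \<in> carrier_mat m n" "B \<in> carrier_mat n p" "i < m" "j < p"
  shows "(A * B) $$ (i, j) = (\<Sum>k<n. A $$ (i, k) * B $$ (k, j))"
  using assms by (auto simp: scalar_prod_def lessThan_atLeast0 intro!: sum.cong)

text \<open>The mixed-product rule: the sum over the composite inner index factors into one sum per
  system.\<close>

lemma tensor_mat_mult:
  assumes A: "A \<in> carrier_mat m n" and B: "B \<in> carrier_mat p q"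
    and C: "C \<in> carrier_mat n k" and D: "D \<in> carrier_mat q l"
  shows "tensor_mat A B * tensor_mat C D = tensor_mat (A * C) (B * D)"
proof (rule eq_matI)
  note c = mult_carrier_mat[OF A C] mult_carrier_mat[OF B D]
  fix i j assume "i < dim_row (tensor_mat (A * C) (B * D))" "j < dim_col (tensor_mat (A * C) (B * D))"
  then have ij: "i < m * p" "j < k * l" using assms by (auto simp: tensor_mat_def)
  note b = div_less_mult[OF ij(1)] div_less_mult[OF ij(2)] mod_less_mult[OF ij(1)] mod_less_mult[OF ij(2)]
  have "(tensor_mat A B * tensor_mat C D) $$ (i, j) =
      (\<Sum>x<n * q. tensor_mat A B $$ (i, x) * tensor_mat C D $$ (x, j))"
    using assms ij by (intro mat_mult_index_sum) auto
  also have "\<dots> = (\<Sum>a<n. \<Sum>y<q. A $$ (i div p, a) * C $$ (a, j div l) * (B $$ (i mod p, y) * D $$ (y, j mod l)))"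
    unfolding sum_lessThan_mult
    using assms ij by (intro sum.cong refl)
      (simp add: tensor_mat_index[OF A B] tensor_mat_index[OF C D] mult_add_less_mult)
  also have "\<dots> = (A * C) $$ (i div p, j div l) * (B * D) $$ (i mod p, j mod l)"
    by (simp only: mat_mult_index_sum[OF A C b(1,2)] mat_mult_index_sum[OF B D b(3,4)] sum_product)
  finally show "(tensor_mat A B * tensor_mat C D) $$ (i, j) = tensor_mat (A * C) (B * D) $$ (i, j)"
    using ij by (simp add: tensor_mat_index[OF c])
qed (use assms in \<open>auto simp: tensor_mat_def\<close>)

lemma mat_adjoint_tensor_mat: "mat_adjoint (tensor_mat A B) = tensor_mat (mat_adjoint A) (mat_adjoint B)"
  by (rule eq_matI)
    (auto simp: tensor_mat_def mat_adjoint_index div_less_mult mod_less_mult conjugate_dist_mul)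

lemma mat_adjoint_one [simp]: "mat_adjoint (1\<^sub>m n) = (1\<^sub>m n :: complex mat)"
  by (rule eq_matI) (auto simp: mat_adjoint_index)

lemma tensor_mat_diff_right:
  assumes "A \<in> carrier_mat m n" "B \<in> carrier_mat p q" "C \<in> carrier_mat p q"
  shows "tensor_mat A (B - C) = tensor_mat A B - tensor_mat A C"
proof (rule eq_matI)
  have BC: "B - C \<in> carrier_mat p q" using assms by auto
  fix i j assume "i < dim_row (tensor_mat A B - tensor_mat A C)" "j < dim_col (tensor_mat A B - tensor_mat A C)"
  then have ij: "i < m * p" "j < n * q" using assms by (auto simp: tensor_mat_def)
  show "tensor_mat A (B - C) $$ (i, j) = (tensor_mat A B - tensor_mat A C) $$ (i, j)"
    using ij assms mod_less_mult[OF ij(1)] mod_less_mult[OF ij(2)]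
    by (simp add: tensor_mat_index[OF assms(1) BC] tensor_mat_index[OF assms(1,2)]
        tensor_mat_index[OF assms(1,3)] carrier_matD[OF tensor_mat_carrier[OF assms(1,3)]]
        right_diff_distrib)
qed (use assms in \<open>auto simp: tensor_mat_def\<close>)

lemma ptranspose_B_carrier [simp]: "ptranspose_B dA dB M \<in> carrier_mat (dA * dB) (dA * dB)"
  by (auto simp: ptranspose_B_def)

lemma ptranspose_B_index:
  "i < dA * dB \<Longrightarrow> j < dA * dB \<Longrightarrow>
    ptranspose_B dA dB M $$ (i, j) = M $$ (i div dB * dB + j mod dB, j div dB * dB + i mod dB)"
  by (simp add: ptranspose_B_def)

text \<open>The sums over \<open>b'\<close>, \<open>a\<close>, \<open>b\<close> stand next to each
  other, so that \<open>sum_swap_outer\<close> can exchange the roles of \<open>b\<close> and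
  \<open>b'\<close>.\<close>

lemma tensor_sandwich_index:
  assumes A: "A \<in> carrier_mat m n" and B: "B \<in> carrier_mat p q"
    and X: "X \<in> carrier_mat (n * q) (n * q)"
    and C: "C \<in> carrier_mat n m" and D: "D \<in> carrier_mat q p"
    and ij: "i < m * p" "j < m * p"
  shows "(tensor_mat A B * X * tensor_mat C D) $$ (i, j) =
    (\<Sum>a'<n. \<Sum>b'<q. \<Sum>a<n. \<Sum>b<q. A $$ (i div p, a) * B $$ (i mod p, b) *
      X $$ (a * q + b, a' * q + b') * (C $$ (a', j div p) * D $$ (b', j mod p)))"
proof -
  note TAB = tensor_mat_carrier[OF A B]
  have "(tensor_mat A B * X * tensor_mat C D) $$ (i, j) =
      (\<Sum>y<n * q. (\<Sum>x<n * q. tensor_mat A B $$ (i, x) * X $$ (x, y)) * tensor_mat C D $$ (y, j))"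
    by (subst mat_mult_index_sum[OF mult_carrier_mat[OF TAB X] tensor_mat_carrier[OF C D] ij],
        intro sum.cong refl, subst mat_mult_index_sum[OF TAB X ij(1)]) auto
  also have "\<dots> = (\<Sum>a'<n. \<Sum>b'<q. (\<Sum>a<n. \<Sum>b<q. A $$ (i div p, a) * B $$ (i mod p, b) *
      X $$ (a * q + b, a' * q + b')) * (C $$ (a', j div p) * D $$ (b', j mod p)))"
    unfolding sum_lessThan_mult
    using ij by (intro sum.cong refl arg_cong2[where f = "(*)"])
      (simp_all add: tensor_mat_index[OF A B] tensor_mat_index[OF C D] mult_add_less_mult)
  finally show ?thesis
    by (simp add: sum_distrib_right)
qed

text \<open>Partial transposition exchanges Bob's row and column indices. Bob's factors therefore
  change sides and get transposed, while Alice's stay in place. This uses the product form of both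
  outer factors and is the reason why local Kraus operators respect positivity of the partial
  transpose.\<close>

lemma ptranspose_B_sandwich:
  assumes A: "A \<in> carrier_mat m n" and B: "B \<in> carrier_mat p q"
    and X: "X \<in> carrier_mat (n * q) (n * q)"
    and C: "C \<in> carrier_mat n m" and D: "D \<in> carrier_mat q p"
  shows "ptranspose_B m p (tensor_mat A B * X * tensor_mat C D) =
    tensor_mat A (transpose_mat D) * ptranspose_B n q X * tensor_mat C (transpose_mat B)"
    (is "?L = ?R")
proof (rule eq_matI)
  have BT: "transpose_mat B \<in> carrier_mat q p" and DT: "transpose_mat D \<in> carrier_mat p q"
    using B D by auto
  show "dim_row ?L = dim_row ?R" "dim_col ?L = dim_col ?R"
    using assms by (auto simp: ptranspose_B_def tensor_mat_def)
  fix i j assume "i < dim_row ?R" "j < dim_col ?R"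
  then have ij: "i < m * p" "j < m * p"
    using carrier_matD[OF tensor_mat_carrier[OF A DT]] carrier_matD[OF tensor_mat_carrier[OF C BT]] by auto
  note b = div_less_mult[OF ij(1)] div_less_mult[OF ij(2)] mod_less_mult[OF ij(1)] mod_less_mult[OF ij(2)]
  have "?L $$ (i, j) = (\<Sum>a'<n. \<Sum>b'<q. \<Sum>a<n. \<Sum>b<q. A $$ (i div p, a) * B $$ (j mod p, b) *
      X $$ (a * q + b, a' * q + b') * (C $$ (a', j div p) * D $$ (b', i mod p)))"
    using b by (simp add: ptranspose_B_index[OF ij] mult_add_less_mult
        tensor_sandwich_index[OF assms])
  \<comment> \<open>Bob's two summation indices trade names, so that \<open>X\<close> appears with
    exactly the indices of an entry of its partial transpose.\<close>
  also have "\<dots> = (\<Sum>a'<n. \<Sum>b'<q. \<Sum>a<n. \<Sum>b<q. A $$ (i div p, a) * B $$ (j mod p, b') *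
      X $$ (a * q + b', a' * q + b) * (C $$ (a', j div p) * D $$ (b, i mod p)))"
    by (rule sum.cong[OF refl sum_swap_outer])
  also have "\<dots> = ?R $$ (i, j)"
    unfolding tensor_sandwich_index[OF A DT ptranspose_B_carrier C BT ij]
    using b B D by (intro sum.cong refl) (simp add: ptranspose_B_index mult_add_less_mult)
  finally show "?L $$ (i, j) = ?R $$ (i, j)" .
qed

section \<open>Positivity and duality of Kraus maps\<close>

lemma mat_sum_Nil [simp]: "mat_sum d [] = 0\<^sub>m d d"
  by (rule eq_matI) (auto simp: mat_sum_def)

lemma mat_sum_carrier [simp]: "mat_sum d Ms \<in> carrier_mat d d"
  by (simp add: mat_sum_def)

lemma mat_sum_Cons: "M \<in> carrier_mat d d \<Longrightarrow> mat_sum d (M # Ms) = M + mat_sum d Ms"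
  by (rule eq_matI) (auto simp: mat_sum_def)

lemma kraus_map_carrier [simp]: "kraus_map d Ks \<rho> \<in> carrier_mat d d"
  by (simp add: kraus_map_def)

section \<open>Linearity in finite sums, and local instruments on the joint system\<close>

lemma tensor_mat_sum_right:
  assumes "set Ms \<subseteq> carrier_mat n n"
  shows "tensor_mat (1\<^sub>m m) (mat_sum n Ms) = mat_sum (m * n) (map (tensor_mat (1\<^sub>m m)) Ms)"
proof (rule eq_matI)
  fix i j assume "i < dim_row (mat_sum (m * n) (map (tensor_mat (1\<^sub>m m)) Ms))"
    "j < dim_col (mat_sum (m * n) (map (tensor_mat (1\<^sub>m m)) Ms))"
  then have ij: "i < m * n" "j < m * n" by (auto simp: mat_sum_def)
  have "(\<Sum>M\<leftarrow>Ms. tensor_mat (1\<^sub>m m) M $$ (i, j)) =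
    (\<Sum>M\<leftarrow>Ms. 1\<^sub>m m $$ (i div n, j div n) * M $$ (i mod n, j mod n))"
    using assms ij by (intro arg_cong[where f = sum_list] map_cong refl tensor_mat_index[of _ m m]) auto
  then show "tensor_mat (1\<^sub>m m) (mat_sum n Ms) $$ (i, j)
      = mat_sum (m * n) (map (tensor_mat (1\<^sub>m m)) Ms) $$ (i, j)"
    unfolding tensor_mat_index[OF one_carrier_mat mat_sum_carrier ij]
    using ij mod_less_mult[OF ij(1)] mod_less_mult[OF ij(2)]
    by (simp add: mat_sum_def o_def sum_list_const_mult)
qed (auto simp: mat_sum_def tensor_mat_def)

lemma tensor_mat_sum_left:
  assumes "set Ms \<subseteq> carrier_mat m m"
  shows "tensor_mat (mat_sum m Ms) (1\<^sub>m n) = mat_sum (m * n) (map (\<lambda>M. tensor_mat M (1\<^sub>m n)) Ms)"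
proof (rule eq_matI)
  fix i j assume "i < dim_row (mat_sum (m * n) (map (\<lambda>M. tensor_mat M (1\<^sub>m n)) Ms))"
    "j < dim_col (mat_sum (m * n) (map (\<lambda>M. tensor_mat M (1\<^sub>m n)) Ms))"
  then have ij: "i < m * n" "j < m * n" by (auto simp: mat_sum_def)
  have "(\<Sum>M\<leftarrow>Ms. tensor_mat M (1\<^sub>m n) $$ (i, j)) =
    (\<Sum>M\<leftarrow>Ms. M $$ (i div n, j div n) * 1\<^sub>m n $$ (i mod n, j mod n))"
    using assms ij by (intro arg_cong[where f = sum_list] map_cong refl tensor_mat_index[of _ m m _ n n]) auto
  then show "tensor_mat (mat_sum m Ms) (1\<^sub>m n) $$ (i, j)
      = mat_sum (m * n) (map (\<lambda>M. tensor_mat M (1\<^sub>m n)) Ms) $$ (i, j)"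
    unfolding tensor_mat_index[OF mat_sum_carrier one_carrier_mat ij]
    using ij div_less_mult[OF ij(1)] div_less_mult[OF ij(2)]
    by (simp add: mat_sum_def o_def sum_list_mult_const)
qed (auto simp: mat_sum_def tensor_mat_def)

lemma ptranspose_B_mat_sum:
  "ptranspose_B dA dB (mat_sum (dA * dB) Ms) = mat_sum (dA * dB) (map (ptranspose_B dA dB) Ms)"
proof (rule eq_matI)
  fix i j assume "i < dim_row (mat_sum (dA * dB) (map (ptranspose_B dA dB) Ms))"
    "j < dim_col (mat_sum (dA * dB) (map (ptranspose_B dA dB) Ms))"
  then have ij: "i < dA * dB" "j < dA * dB" by (auto simp: mat_sum_def)
  note b = div_less_mult[OF ij(1)] div_less_mult[OF ij(2)] mod_less_mult[OF ij(1)] mod_less_mult[OF ij(2)]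
  show "ptranspose_B dA dB (mat_sum (dA * dB) Ms) $$ (i, j)
      = mat_sum (dA * dB) (map (ptranspose_B dA dB) Ms) $$ (i, j)"
    using ij mult_add_less_mult[OF b(1,4)] mult_add_less_mult[OF b(2,3)]
    by (simp add: ptranspose_B_index mat_sum_def o_def)
qed (auto simp: mat_sum_def ptranspose_B_def)

text \<open>By the mixed-product rule, \<open>K \<otimes> 1\<close> has the Gram matrix
  \<open>mat_adjoint K * K\<close> tensored with the identity. The completeness relation on Alice's
  side thus tensors up to the one on the joint system.\<close>

lemma instrument_alice:
  assumes "instrument dA n e Ks"
  shows "instrument (dA * dB) n (\<lambda>i. e i * dB) (\<lambda>i. map (\<lambda>K. tensor_mat K (1\<^sub>m dB)) (Ks i))"
proof -
  let ?Ks = "concat (map Ks [0..<n])"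
  have Ks: "K \<in> carrier_mat (e i) dA" if "i < n" "K \<in> set (Ks i)" for i K
    using assms that by (auto simp: instrument_def)
  have sum: "mat_sum dA (map (\<lambda>K. mat_adjoint K * K) ?Ks) = 1\<^sub>m dA"
    using assms by (auto simp: instrument_def)
  \<comment> \<open>The concatenated list forgets the outcome \<open>i\<close>, so
    \<open>dim_row K\<close> takes the place of the output dimension \<open>e i\<close>.\<close>
  have K: "K \<in> carrier_mat (dim_row K) dA" if "K \<in> set ?Ks" for K
    using that by (auto simp: carrier_matD(2)[OF Ks] intro!: carrier_matI)
  have adj: "mat_adjoint (tensor_mat K (1\<^sub>m dB)) * tensor_mat K (1\<^sub>m dB)
      = tensor_mat (mat_adjoint K * K) (1\<^sub>m dB)" if "K \<in> set ?Ks" for K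

  proof -
    note k = K[OF that]
    show ?thesis
      using tensor_mat_mult[OF mat_adjoint_carrier[OF k] one_carrier_mat k one_carrier_mat]
      by (simp add: mat_adjoint_tensor_mat)
  qed
  have "mat_sum (dA * dB) (map (\<lambda>L. mat_adjoint L * L)
      (concat (map (\<lambda>i. map (\<lambda>K. tensor_mat K (1\<^sub>m dB)) (Ks i)) [0..<n])))
    = mat_sum (dA * dB) (map (\<lambda>K. mat_adjoint (tensor_mat K (1\<^sub>m dB)) * tensor_mat K (1\<^sub>m dB)) ?Ks)"
    by (simp add: map_concat o_def)
  also have "\<dots> = mat_sum (dA * dB) (map (\<lambda>M. tensor_mat M (1\<^sub>m dB)) (map (\<lambda>K. mat_adjoint K * K) ?Ks))"
    using adj by (intro arg_cong[where f = "mat_sum _"]) (simp only: map_map o_def cong: map_cong)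
  also have "\<dots> = tensor_mat (mat_sum dA (map (\<lambda>K. mat_adjoint K * K) ?Ks)) (1\<^sub>m dB)"
  proof (rule tensor_mat_sum_left[symmetric])
    show "set (map (\<lambda>K. mat_adjoint K * K) ?Ks) \<subseteq> carrier_mat dA dA"
      unfolding set_map using K mat_adjoint_carrier mult_carrier_mat by (blast)
  qed
  also have "\<dots> = 1\<^sub>m (dA * dB)"
    unfolding sum by (rule tensor_mat_one)
  finally show ?thesis
    using Ks by (auto simp: instrument_def)
qed

lemma instrument_bob:
  assumes "instrument dB n e Ks"
  shows "instrument (dA * dB) n (\<lambda>i. dA * e i) (\<lambda>i. map (tensor_mat (1\<^sub>m dA)) (Ks i))"
proof -
  let ?Ks = "concat (map Ks [0..<n])"
  have Ks: "K \<in> carrier_mat (e i) dB" if "i < n" "K \<in> set (Ks i)" for i K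
    using assms that by (auto simp: instrument_def)
  have sum: "mat_sum dB (map (\<lambda>K. mat_adjoint K * K) ?Ks) = 1\<^sub>m dB"
    using assms by (auto simp: instrument_def)
  have K: "K \<in> carrier_mat (dim_row K) dB" if "K \<in> set ?Ks" for K
    using that by (auto simp: carrier_matD(2)[OF Ks] intro!: carrier_matI)
  have adj: "mat_adjoint (tensor_mat (1\<^sub>m dA) K) * tensor_mat (1\<^sub>m dA) K
      = tensor_mat (1\<^sub>m dA) (mat_adjoint K * K)" if "K \<in> set ?Ks" for K

  proof -
    note k = K[OF that]
    show ?thesis
      using tensor_mat_mult[OF one_carrier_mat mat_adjoint_carrier[OF k] one_carrier_mat k]
      by (simp add: mat_adjoint_tensor_mat)
  qed
  have "mat_sum (dA * dB) (map (\<lambda>L. mat_adjoint L * L)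
      (concat (map (\<lambda>i. map (tensor_mat (1\<^sub>m dA)) (Ks i)) [0..<n])))
    = mat_sum (dA * dB) (map (\<lambda>K. mat_adjoint (tensor_mat (1\<^sub>m dA) K) * tensor_mat (1\<^sub>m dA) K) ?Ks)"
    by (simp add: map_concat o_def)
  also have "\<dots> = mat_sum (dA * dB) (map (tensor_mat (1\<^sub>m dA)) (map (\<lambda>K. mat_adjoint K * K) ?Ks))"
    using adj by (intro arg_cong[where f = "mat_sum _"]) (simp only: map_map o_def cong: map_cong)
  also have "\<dots> = tensor_mat (1\<^sub>m dA) (mat_sum dB (map (\<lambda>K. mat_adjoint K * K) ?Ks))"
  proof (rule tensor_mat_sum_right[symmetric])
    show "set (map (\<lambda>K. mat_adjoint K * K) ?Ks) \<subseteq> carrier_mat dB dB"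
      unfolding set_map using K mat_adjoint_carrier mult_carrier_mat by (blast)
  qed
  also have "\<dots> = 1\<^sub>m (dA * dB)"
    unfolding sum by (rule tensor_mat_one)
  finally show ?thesis
    using Ks by (auto simp: instrument_def)
qed

section \<open>Positive semidefinite matrices and effects\<close>

lemma psd_carrier: "psd d M \<Longrightarrow> M \<in> carrier_mat d d"
  by (simp add: psd_def)

lemma psd_zero: "psd d (0\<^sub>m d d)"
  by (auto simp: psd_def scalar_prod_def)

lemma psd_add:
  assumes "psd d M" "psd d N"
  shows "psd d (M + N)"
proof -
  have MN: "M \<in> carrier_mat d d" "N \<in> carrier_mat d d" using assms by (auto simp: psd_def)
  have "0 \<le> ((M + N) *\<^sub>v v) \<bullet>c v" if v: "v \<in> carrier_vec d" for v
  proof -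
    have "((M + N) *\<^sub>v v) \<bullet>c v = (M *\<^sub>v v) \<bullet>c v + (N *\<^sub>v v) \<bullet>c v"
      using MN v by (simp add: add_mult_distrib_mat_vec[of _ d d] add_scalar_prod_distrib[of _ d])
    then show ?thesis using assms v by (auto simp: psd_def intro: add_nonneg_nonneg)
  qed
  then show ?thesis using MN by (auto simp: psd_def)
qed

lemma psd_mat_sum: "(\<And>M. M \<in> set Ms \<Longrightarrow> psd d M) \<Longrightarrow> psd d (mat_sum d Ms)"
  by (induction Ms) (auto simp: psd_zero mat_sum_Cons psd_carrier psd_add)

lemma scalar_prod_mat_adjoint:
  fixes L :: "complex mat"
  assumes L: "L \<in> carrier_mat m n" and w: "w \<in> carrier_vec m" and v: "v \<in> carrier_vec n"
  shows "(mat_adjoint L *\<^sub>v w) \<bullet>c v = w \<bullet>c (L *\<^sub>v v)"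
proof -
  have "(mat_adjoint L *\<^sub>v w) \<bullet>c v = (\<Sum>i<n. \<Sum>j<m. cnj (L $$ (j, i)) * w $ j * cnj (v $ i))"
    using assms by (auto simp: scalar_prod_def mat_adjoint_index sum_distrib_right
        lessThan_atLeast0 intro!: sum.cong)
  also have "\<dots> = (\<Sum>j<m. \<Sum>i<n. cnj (L $$ (j, i)) * w $ j * cnj (v $ i))"
    by (rule sum.swap)
  also have "\<dots> = w \<bullet>c (L *\<^sub>v v)"
    using assms by (auto simp: scalar_prod_def sum_distrib_left
        lessThan_atLeast0 ac_simps intro!: sum.cong)
  finally show ?thesis .
qed

text \<open>The quadratic form of \<open>mat_adjoint L * X * L\<close> at \<open>v\<close> is that
  of \<open>X\<close> at \<open>L *\<^sub>v v\<close>.\<close>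

lemma psd_congruence:
  assumes X: "psd m X" and L: "L \<in> carrier_mat m n"
  shows "psd n (mat_adjoint L * X * L)"
proof -
  have Xc: "X \<in> carrier_mat m m" using X by (rule psd_carrier)
  have "(mat_adjoint L * X * L *\<^sub>v v) \<bullet>c v = (X *\<^sub>v (L *\<^sub>v v)) \<bullet>c (L *\<^sub>v v)"
    (is "?q v = _") if v: "v \<in> carrier_vec n" for v
  proof -
    have "mat_adjoint L * X * L *\<^sub>v v = mat_adjoint L *\<^sub>v (X *\<^sub>v (L *\<^sub>v v))"
      using mat_adjoint_carrier[OF L] Xc L v mult_mat_vec_carrier[OF L v]
      by (simp only: assoc_mult_mat_vec[OF mult_carrier_mat[OF mat_adjoint_carrier[OF L] Xc] L v]
          assoc_mult_mat_vec[OF mat_adjoint_carrier[OF L] Xc mult_mat_vec_carrier[OF L v]])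
    then show ?thesis
      using scalar_prod_mat_adjoint[OF L _ v] Xc L v by simp
  qed
  then have "0 \<le> ?q v" if "v \<in> carrier_vec n" for v
    using X that mult_mat_vec_carrier[OF L that] by (simp only: psd_def)
  then show ?thesis
    using mult_carrier_mat[OF mult_carrier_mat[OF mat_adjoint_carrier[OF L] Xc] L]
    unfolding psd_def by blast
qed

definition effect :: "nat \<Rightarrow> complex mat \<Rightarrow> bool" where
  "effect d X \<longleftrightarrow> psd d X \<and> psd d (1\<^sub>m d - X)"

lemma mat_sum_map_minus:
  assumes "\<And>x. x \<in> set xs \<Longrightarrow> f x \<in> carrier_mat d d" "\<And>x. x \<in> set xs \<Longrightarrow> g x \<in> carrier_mat d d"
  shows "mat_sum d (map f xs) - mat_sum d (map g xs) = mat_sum d (map (\<lambda>x. f x - g x) xs)"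
proof (rule eq_matI)
  fix i j assume "i < dim_row (mat_sum d (map (\<lambda>x. f x - g x) xs))"
    "j < dim_col (mat_sum d (map (\<lambda>x. f x - g x) xs))"
  then have ij: "i < d" "j < d" by (auto simp: mat_sum_def)
  have "(\<Sum>x\<leftarrow>xs. (f x - g x) $$ (i, j)) = (\<Sum>x\<leftarrow>xs. f x $$ (i, j) - g x $$ (i, j))"
    by (intro arg_cong[where f = sum_list] map_cong refl) (simp add: ij carrier_matD[OF assms(2)])
  then show "(mat_sum d (map f xs) - mat_sum d (map g xs)) $$ (i, j) =
      mat_sum d (map (\<lambda>x. f x - g x) xs) $$ (i, j)"
    using ij by (simp add: mat_sum_def o_def sum_list_subtractf)
qed (auto simp: mat_sum_def)

text \<open>Pulling effects back along a trace preserving family is unital: by completeness, the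
  complement of the result is the sum of the terms \<open>mat_adjoint L * (1 - X) * L\<close>, so
  both order bounds reduce to congruence. Every Kraus operator is paired with an effect of its own,
  because the later protocol, and even its dimension, may depend on the outcome.\<close>

lemma effect_kraus_dual:
  assumes ps: "\<And>X L. (X, L) \<in> set ps \<Longrightarrow> L \<in> carrier_mat (dim_row L) d \<and> effect (dim_row L) X"
    and tp: "mat_sum d (map (\<lambda>(X, L). mat_adjoint L * L) ps) = 1\<^sub>m d"
  shows "effect d (mat_sum d (map (\<lambda>(X, L). mat_adjoint L * X * L) ps))"
proof -
  have 1: "psd d (mat_adjoint L * X * L)" if "(X, L) \<in> set ps" for X L
    using ps[OF that] psd_congruence by (auto simp: effect_def)
  have 2: "psd d (mat_adjoint L * L - mat_adjoint L * X * L) \<and> mat_adjoint L * L \<in> carrier_mat d d"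
    if "(X, L) \<in> set ps" for X L
  proof -
    let ?m = "dim_row L"
    have L: "L \<in> carrier_mat ?m d" and X: "X \<in> carrier_mat ?m ?m" and X': "psd ?m (1\<^sub>m ?m - X)"
      using ps[OF that] by (auto simp: effect_def psd_def)
    note L' = mat_adjoint_carrier[OF L]
    have "mat_adjoint L * (1\<^sub>m ?m - X) * L = mat_adjoint L * L - mat_adjoint L * X * L"
      using mult_minus_distrib_mat[OF L' one_carrier_mat X]
        minus_mult_distrib_mat[OF L' mult_carrier_mat[OF L' X] L] right_mult_one_mat[OF L'] by simp
    then show ?thesis using psd_congruence[OF X' L] mult_carrier_mat[OF L' L] by simp
  qed
  have "1\<^sub>m d - mat_sum d (map (\<lambda>(X, L). mat_adjoint L * X * L) ps) =
    mat_sum d (map (\<lambda>x. (case x of (X, L) \<Rightarrow> mat_adjoint L * L) -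
      (case x of (X, L) \<Rightarrow> mat_adjoint L * X * L)) ps)"
    unfolding tp[symmetric] using 1 2 by (intro mat_sum_map_minus) (auto simp: psd_carrier)
  moreover have "psd d \<dots>"
    using 2 by (intro psd_mat_sum) auto
  moreover have "psd d (mat_sum d (map (\<lambda>(X, L). mat_adjoint L * X * L) ps))"
    using 1 by (intro psd_mat_sum) auto
  ultimately show ?thesis by (simp add: effect_def)
qed

section \<open>Trace identities\<close>

lemma tr_mult_sum:
  assumes "A \<in> carrier_mat m n" "B \<in> carrier_mat n m"
  shows "tr (A * B) = (\<Sum>i<m. \<Sum>j<n. A $$ (i, j) * B $$ (j, i))"
  using assms by (simp add: tr_def mat_mult_index_sum[OF assms] del: index_mult_mat(1))

lemma tr_mult_commute:
  assumes "A \<in> carrier_mat m n" "B \<in> carrier_mat n m"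
  shows "tr (A * B) = tr (B * A)"
  unfolding tr_mult_sum[OF assms] tr_mult_sum[OF assms(2,1)]
  by (subst sum.swap) (simp add: mult.commute)

lemma tr_add:
  assumes "A \<in> carrier_mat n n" "B \<in> carrier_mat n n"
  shows "tr (A + B) = tr A + tr B"
  using assms by (auto simp: tr_def sum.distrib)

lemma tr_mat_sum_mult:
  assumes \<rho>: "\<rho> \<in> carrier_mat d d"
  shows "set Ms \<subseteq> carrier_mat d d \<Longrightarrow> tr (mat_sum d Ms * \<rho>) = (\<Sum>M\<leftarrow>Ms. tr (M * \<rho>))"
proof (induction Ms)
  case Nil
  then show ?case using \<rho> by (simp add: tr_def)
next
  case (Cons M Ms)
  then have M: "M \<in> carrier_mat d d" by simp
  show ?case
    using Cons tr_add[OF mult_carrier_mat[OF M \<rho>] mult_carrier_mat[OF mat_sum_carrier \<rho>]]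
    by (simp add: mat_sum_Cons add_mult_distrib_mat[OF M _ \<rho>])
qed

lemma tr_mult_mat_sum:
  assumes "E \<in> carrier_mat d d" "set Ms \<subseteq> carrier_mat d d"
  shows "tr (E * mat_sum d Ms) = (\<Sum>M\<leftarrow>Ms. tr (E * M))"
proof -
  have "(\<Sum>M\<leftarrow>Ms. tr (M * E)) = (\<Sum>M\<leftarrow>Ms. tr (E * M))"
    using assms by (intro arg_cong[where f = sum_list] map_cong refl tr_mult_commute[of _ d d]) auto
  then show ?thesis
    using tr_mat_sum_mult[OF assms] tr_mult_commute[OF assms(1) mat_sum_carrier] by simp
qed

text \<open>Cyclicity of the trace carries \<open>mat_adjoint L\<close> to the other end. For a
  single Kraus operator this is the passage from the Schroedinger to the Heisenberg picture.\<close>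

lemma tr_kraus_dual:
  assumes L: "L \<in> carrier_mat m n" and X: "X \<in> carrier_mat m m" and \<rho>: "\<rho> \<in> carrier_mat n n"
  shows "tr (mat_adjoint L * X * L * \<rho>) = tr (X * (L * \<rho> * mat_adjoint L))"
proof -
  note L' = mat_adjoint_carrier[OF L]
  note XL = mult_carrier_mat[OF X L]
  note L\<rho> = mult_carrier_mat[OF L \<rho>]
  have "mat_adjoint L * X * L * \<rho> = mat_adjoint L * (X * (L * \<rho>))"
    using L' X L \<rho> XL L\<rho>
    by (simp add: assoc_mult_mat[OF L' X L] assoc_mult_mat[OF L' XL \<rho>] assoc_mult_mat[OF X L \<rho>])
  moreover have "X * (L * \<rho>) * mat_adjoint L = X * (L * \<rho> * mat_adjoint L)"
    by (rule assoc_mult_mat[OF X L\<rho> L'])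
  ultimately show ?thesis
    using tr_mult_commute[OF L' mult_carrier_mat[OF X L\<rho>]] by simp
qed

section \<open>LOCC protocols in the Heisenberg picture\<close>

text \<open>The invariant of the induction over protocols. The trace condition of
  \<open>feasible\<close> is left out because a single round need not be unital; it is recovered at
  the end for the protocol as a whole.\<close>

definition ppt_effect :: "nat \<Rightarrow> nat \<Rightarrow> complex mat \<Rightarrow> bool" where
  "ppt_effect dA dB X \<longleftrightarrow> effect (dA * dB) X \<and> psd (dA * dB) (ptranspose_B dA dB X)"

text \<open>\<open>X\<close> is the image of the effect \<open>E\<close> under the adjoint of \<open>\<Lambda>\<close>.\<close>

definition dual_effect ::
  "nat \<Rightarrow> nat \<Rightarrow> (complex mat \<Rightarrow> complex mat) \<Rightarrow> complex mat \<Rightarrow> complex mat \<Rightarrow> bool" where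
  "dual_effect d c \<Lambda> E X \<longleftrightarrow>
     (\<forall>\<rho> \<in> carrier_mat d d. \<Lambda> \<rho> \<in> carrier_mat c c \<and> tr (E * \<Lambda> \<rho>) = tr (X * \<rho>))"

lemma effect_carrier: "effect d X \<Longrightarrow> X \<in> carrier_mat d d"
  by (simp add: effect_def psd_carrier)

text \<open>One round for either party: the pulled back effect is the sum of
  \<open>mat_adjoint L * X i * L\<close> over all outcomes \<open>i\<close> and their Kraus
  operators \<open>L\<close>. Locality enters only through the assumption \<open>pt\<close>, which
  the lemmas for Alice and Bob discharge separately.\<close>

lemma dual_effect_round:
  assumes E: "E \<in> carrier_mat c c"
    and ins: "instrument (dA * dB) n D Ls"
    and X: "\<And>i. i < n \<Longrightarrow> effect (D i) (X i)"
    and pt: "\<And>i L. i < n \<Longrightarrow> L \<in> set (Ls i) \<Longrightarrow>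
      psd (dA * dB) (ptranspose_B dA dB (mat_adjoint L * X i * L))"
    and dual: "\<And>i. i < n \<Longrightarrow> dual_effect (D i) c (\<Lambda> i) E (X i)"
  shows "\<exists>Y. ppt_effect dA dB Y \<and> dual_effect (dA * dB) c
    (\<lambda>\<rho>. mat_sum c (map (\<lambda>i. \<Lambda> i (kraus_map (D i) (Ls i) \<rho>)) [0..<n])) E Y"
proof -
  define d where "d = dA * dB"
  \<comment> \<open>Each Kraus operator of outcome \<open>i\<close> is paired with the effect
    \<open>X i\<close> that the protocol following this outcome pulls back.\<close>
  define ps where "ps = concat (map (\<lambda>i. map (Pair (X i)) (Ls i)) [0..<n])"
  define Y where "Y = mat_sum d (map (\<lambda>(X, L). mat_adjoint L * X * L) ps)"
  have ps_elim: "\<exists>i<n. Z = X i \<and> L \<in> set (Ls i)" if "(Z, L) \<in> set ps" for Z L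
    using that by (auto simp: ps_def)
  have L: "L \<in> carrier_mat (D i) d" if "i < n" "L \<in> set (Ls i)" for i L
    using ins that by (auto simp: instrument_def d_def)
  have ps: "L \<in> carrier_mat (dim_row L) d \<and> effect (dim_row L) Z" if "(Z, L) \<in> set ps" for Z L
  proof -
    obtain i where i: "i < n" "Z = X i" "L \<in> set (Ls i)" using ps_elim[OF \<open>(Z, L) \<in> set ps\<close>] by blast
    then show ?thesis using X L[OF i(1,3)] carrier_matD(1)[OF L[OF i(1,3)]] by simp
  qed
  have "mat_sum d (map (\<lambda>(X, L). mat_adjoint L * L) ps) = 1\<^sub>m d"
    using ins by (simp add: instrument_def d_def ps_def map_concat o_def)
  then have eff: "effect d Y"
    unfolding Y_def by (intro effect_kraus_dual ps)
  have "psd d (ptranspose_B dA dB Y)"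
    unfolding Y_def d_def ptranspose_B_mat_sum using pt ps_elim
    by (intro psd_mat_sum) (fastforce)
  with eff have ppt: "ppt_effect dA dB Y"
    by (simp add: ppt_effect_def d_def)
  have "dual_effect d c (\<lambda>\<rho>. mat_sum c (map (\<lambda>i. \<Lambda> i (kraus_map (D i) (Ls i) \<rho>)) [0..<n])) E Y"
    unfolding dual_effect_def
  proof (intro ballI conjI mat_sum_carrier)
    fix \<rho> :: "complex mat"
    assume \<rho>: "\<rho> \<in> carrier_mat d d"
    have round: "tr (E * \<Lambda> i (kraus_map (D i) (Ls i) \<rho>))
        = (\<Sum>L\<leftarrow>Ls i. tr (mat_adjoint L * X i * L * \<rho>))"
      and \<Lambda>: "\<Lambda> i (kraus_map (D i) (Ls i) \<rho>) \<in> carrier_mat c c" if i: "i < n" for i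
    proof -
      note Xi = effect_carrier[OF X[OF i]]
      show "\<Lambda> i (kraus_map (D i) (Ls i) \<rho>) \<in> carrier_mat c c"
        using dual[OF i] kraus_map_carrier unfolding dual_effect_def by blast
      have "tr (E * \<Lambda> i (kraus_map (D i) (Ls i) \<rho>)) = tr (X i * kraus_map (D i) (Ls i) \<rho>)"
        using dual[OF i] kraus_map_carrier unfolding dual_effect_def by blast
      also have "\<dots> = (\<Sum>M\<leftarrow>map (\<lambda>L. L * \<rho> * mat_adjoint L) (Ls i). tr (X i * M))"
        unfolding kraus_map_def
        using mult_carrier_mat[OF mult_carrier_mat[OF L[OF i] \<rho>] mat_adjoint_carrier[OF L[OF i]]]
        by (intro tr_mult_mat_sum Xi) auto
      also have "\<dots> = (\<Sum>L\<leftarrow>Ls i. tr (mat_adjoint L * X i * L * \<rho>))"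
        using tr_kraus_dual[OF L[OF i] Xi \<rho>]
        by (auto simp: o_def intro!: arg_cong[where f = sum_list] map_cong)
      finally show "tr (E * \<Lambda> i (kraus_map (D i) (Ls i) \<rho>))
        = (\<Sum>L\<leftarrow>Ls i. tr (mat_adjoint L * X i * L * \<rho>))" .
    qed
    have "tr (E * mat_sum c (map (\<lambda>i. \<Lambda> i (kraus_map (D i) (Ls i) \<rho>)) [0..<n]))
        = (\<Sum>M\<leftarrow>map (\<lambda>i. \<Lambda> i (kraus_map (D i) (Ls i) \<rho>)) [0..<n]. tr (E * M))"
      using \<Lambda> by (intro tr_mult_mat_sum E) auto
    also have "\<dots> = (\<Sum>i\<leftarrow>[0..<n]. \<Sum>L\<leftarrow>Ls i. tr (mat_adjoint L * X i * L * \<rho>))"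
      using round by (auto simp: o_def intro!: arg_cong[where f = sum_list] map_cong)
    also have "\<dots> = (\<Sum>M\<leftarrow>map (\<lambda>(X, L). mat_adjoint L * X * L) ps. tr (M * \<rho>))"
      unfolding ps_def by (induction n) (auto simp: o_def)
    also have "\<dots> = tr (Y * \<rho>)"
    proof -
      have "set (map (\<lambda>(X, L). mat_adjoint L * X * L) ps) \<subseteq> carrier_mat d d"
      proof
        fix M assume "M \<in> set (map (\<lambda>(X, L). mat_adjoint L * X * L) ps)"
        then obtain Z L where ZL: "(Z, L) \<in> set ps" "M = mat_adjoint L * Z * L" by auto
        note * = ps[OF ZL(1)]
        show "M \<in> carrier_mat d d"
          unfolding ZL(2) using * mult_carrier_mat mat_adjoint_carrier effect_carrier by metis
      qed
      then show ?thesis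
        unfolding Y_def by (intro tr_mat_sum_mult[symmetric] \<rho>)
    qed
    finally show "tr (E * mat_sum c (map (\<lambda>i. \<Lambda> i (kraus_map (D i) (Ls i) \<rho>)) [0..<n])) = tr (Y * \<rho>)" .
  qed
  with ppt show ?thesis unfolding d_def by blast
qed

text \<open>Bob's factors are identities, which transposition fixes, so Alice's Kraus operator
  passes through the partial transpose unchanged.\<close>

lemma psd_ptranspose_B_alice:
  assumes X: "ppt_effect a dB X" and K: "K \<in> carrier_mat a dA"
  shows "psd (dA * dB) (ptranspose_B dA dB
    (mat_adjoint (tensor_mat K (1\<^sub>m dB)) * X * tensor_mat K (1\<^sub>m dB)))"
proof -
  have Xc: "X \<in> carrier_mat (a * dB) (a * dB)"
    using X by (simp add: ppt_effect_def effect_carrier)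
  have "ptranspose_B dA dB (mat_adjoint (tensor_mat K (1\<^sub>m dB)) * X * tensor_mat K (1\<^sub>m dB)) =
      mat_adjoint (tensor_mat K (1\<^sub>m dB)) * ptranspose_B a dB X * tensor_mat K (1\<^sub>m dB)"
    using ptranspose_B_sandwich[OF mat_adjoint_carrier[OF K] one_carrier_mat Xc K one_carrier_mat]
    by (simp add: mat_adjoint_tensor_mat)
  moreover have "psd (dA * dB) \<dots>"
    using X K by (intro psd_congruence[where m = "a * dB"]) (auto simp: ppt_effect_def)
  ultimately show ?thesis by simp
qed

lemma mat_adjoint_transpose_adjoint: "mat_adjoint (transpose_mat (mat_adjoint A)) = transpose_mat A"
  by (rule eq_matI) (auto simp: mat_adjoint_index)

lemma psd_ptranspose_B_bob:
  assumes X: "ppt_effect dA b X" and K: "K \<in> carrier_mat b dB"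
  shows "psd (dA * dB) (ptranspose_B dA dB
    (mat_adjoint (tensor_mat (1\<^sub>m dA) K) * X * tensor_mat (1\<^sub>m dA) K))"
proof -
  \<comment> \<open>This is the entrywise complex conjugate of \<open>K\<close>: the partial
    transpose of the pulled back effect is again a congruence, with \<open>K\<close>
    conjugated.\<close>
  let ?K = "transpose_mat (mat_adjoint K)"
  have Xc: "X \<in> carrier_mat (dA * b) (dA * b)"
    using X by (simp add: ppt_effect_def effect_carrier)
  have K': "?K \<in> carrier_mat b dB" using mat_adjoint_carrier[OF K] by simp
  have "ptranspose_B dA dB (mat_adjoint (tensor_mat (1\<^sub>m dA) K) * X * tensor_mat (1\<^sub>m dA) K) =
      mat_adjoint (tensor_mat (1\<^sub>m dA) ?K) * ptranspose_B dA b X * tensor_mat (1\<^sub>m dA) ?K"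
    using ptranspose_B_sandwich[OF one_carrier_mat mat_adjoint_carrier[OF K] Xc one_carrier_mat K]
    by (simp add: mat_adjoint_tensor_mat mat_adjoint_transpose_adjoint)
  moreover have "psd (dA * dB) \<dots>"
    using X K' by (intro psd_congruence[where m = "dA * b"]) (auto simp: ppt_effect_def)
  ultimately show ?thesis by simp
qed

text \<open>The induction removes the first round: the continuations after it pull \<open>E\<close>
  back to effects \<open>X i\<close> by hypothesis, and the first round combines these into one. For
  \<open>stop\<close> the effect is \<open>E\<close> itself.\<close>

lemma locc_dual_effect:
  assumes "locc cA cB dA dB \<Lambda>" and E: "ppt_effect cA cB E"
  shows "\<exists>X. ppt_effect dA dB X \<and> dual_effect (dA * dB) (cA * cB) \<Lambda> E X"
  using assms(1)
proof induction
  case stop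
  then show ?case using E by (auto simp: dual_effect_def)
next
  case (alice dA n e Ks dB \<Lambda>)
  \<comment> \<open>The bound on \<open>i\<close> stands inside the existential, so that choice
    yields a function \<open>X\<close> of all outcomes.\<close>
  have "\<forall>i. \<exists>X. i < n \<longrightarrow> ppt_effect (e i) dB X \<and> dual_effect (e i * dB) (cA * cB) (\<Lambda> i) E X"
    using alice.IH by blast
  then obtain X where X: "\<And>i. i < n \<Longrightarrow> ppt_effect (e i) dB (X i)"
    "\<And>i. i < n \<Longrightarrow> dual_effect (e i * dB) (cA * cB) (\<Lambda> i) E (X i)"
    by metis
  show ?case
  proof (rule dual_effect_round[OF _ instrument_alice[OF alice.hyps(1)] _ _ X(2)])
    show "E \<in> carrier_mat (cA * cB) (cA * cB)"
      using E by (simp add: ppt_effect_def effect_carrier)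
    show "effect (e i * dB) (X i)" if "i < n" for i
      using X(1)[OF that] by (simp add: ppt_effect_def)
    show "psd (dA * dB) (ptranspose_B dA dB (mat_adjoint L * X i * L))"
      if "i < n" "L \<in> set (map (\<lambda>K. tensor_mat K (1\<^sub>m dB)) (Ks i))" for i L
    proof -
      obtain K where K: "K \<in> set (Ks i)" "L = tensor_mat K (1\<^sub>m dB)" using \<open>L \<in> _\<close> by auto
      have "K \<in> carrier_mat (e i) dA"
        using alice.hyps(1) that K by (auto simp: instrument_def)
      then show ?thesis
        unfolding K(2) by (rule psd_ptranspose_B_alice[OF X(1)[OF \<open>i < n\<close>]])
    qed
  qed
next
  case (bob dB n e Ks dA \<Lambda>)
  have "\<forall>i. \<exists>X. i < n \<longrightarrow> ppt_effect dA (e i) X \<and> dual_effect (dA * e i) (cA * cB) (\<Lambda> i) E X"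
    using bob.IH by blast
  then obtain X where X: "\<And>i. i < n \<Longrightarrow> ppt_effect dA (e i) (X i)"
    "\<And>i. i < n \<Longrightarrow> dual_effect (dA * e i) (cA * cB) (\<Lambda> i) E (X i)"
    by metis
  show ?case
  proof (rule dual_effect_round[OF _ instrument_bob[OF bob.hyps(1)] _ _ X(2)])
    show "E \<in> carrier_mat (cA * cB) (cA * cB)"
      using E by (simp add: ppt_effect_def effect_carrier)
    show "effect (dA * e i) (X i)" if "i < n" for i
      using X(1)[OF that] by (simp add: ppt_effect_def)
    show "psd (dA * dB) (ptranspose_B dA dB (mat_adjoint L * X i * L))"
      if "i < n" "L \<in> set (map (tensor_mat (1\<^sub>m dA)) (Ks i))" for i L
    proof -
      obtain K where K: "K \<in> set (Ks i)" "L = tensor_mat (1\<^sub>m dA) K" using \<open>L \<in> _\<close> by auto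
      have "K \<in> carrier_mat (e i) dB"
        using bob.hyps(1) that K by (auto simp: instrument_def)
      then show ?thesis
        unfolding K(2) by (rule psd_ptranspose_B_bob[OF X(1)[OF \<open>i < n\<close>]])
    qed
  qed
qed

section \<open>The observable \<open>1 \<otimes> |\<psi>\<rangle>\<langle>\<psi>|\<close> and its
  pullback\<close>

definition pure_proj :: "nat \<Rightarrow> complex vec \<Rightarrow> complex mat" where
  "pure_proj d \<psi> = mat d d (\<lambda>(i, j). \<psi> $ i * cnj (\<psi> $ j))"

lemma pure_proj_carrier [simp]: "pure_proj d \<psi> \<in> carrier_mat d d"
  by (simp add: pure_proj_def)

lemma pure_proj_index [simp]: "i < d \<Longrightarrow> j < d \<Longrightarrow> pure_proj d \<psi> $$ (i, j) = \<psi> $ i * cnj (\<psi> $ j)"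
  by (simp add: pure_proj_def)

lemma mat_minus_zero:
  fixes A :: "complex mat"
  shows "A \<in> carrier_mat m n \<Longrightarrow> A - 0\<^sub>m m n = A"
  by (intro eq_matI) auto

lemma psd_one: "psd d (1\<^sub>m d)"
proof -
  have "0 \<le> v \<bullet>c v" if "v \<in> carrier_vec d" for v :: "complex vec"
    by (auto simp: scalar_prod_def less_eq_complex_def intro!: add_nonneg_nonneg sum_nonneg)
  then show ?thesis by (auto simp: psd_def)
qed

text \<open>This is the congruence of the identity by \<open>1 \<otimes> A\<close>. It applies to
  every orthogonal projection \<open>P\<close>, as \<open>mat_adjoint P * P = P\<close>.\<close>

lemma psd_tensor_gram:
  assumes A: "A \<in> carrier_mat k n"
  shows "psd (m * n) (tensor_mat (1\<^sub>m m) (mat_adjoint A * A))"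
proof -
  let ?L = "tensor_mat (1\<^sub>m m) A"
  have L: "?L \<in> carrier_mat (m * k) (m * n)" using A by simp
  have "tensor_mat (1\<^sub>m m) (mat_adjoint A * A) = mat_adjoint ?L * 1\<^sub>m (m * k) * ?L"
    using tensor_mat_mult[OF one_carrier_mat mat_adjoint_carrier[OF A] one_carrier_mat A, of m]
      right_mult_one_mat[OF mat_adjoint_carrier[OF L]]
    by (simp add: mat_adjoint_tensor_mat)
  then show ?thesis using psd_congruence[OF psd_one L] by simp
qed

lemma ptranspose_B_tensor_mat:
  assumes M: "M \<in> carrier_mat m m" and N: "N \<in> carrier_mat n n"
  shows "ptranspose_B m n (tensor_mat M N) = tensor_mat M (transpose_mat N)"
proof (rule eq_matI)
  have N': "transpose_mat N \<in> carrier_mat n n" using N by simp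
  show "dim_row (ptranspose_B m n (tensor_mat M N)) = dim_row (tensor_mat M (transpose_mat N))"
    "dim_col (ptranspose_B m n (tensor_mat M N)) = dim_col (tensor_mat M (transpose_mat N))"
    using M N by (auto simp: ptranspose_B_def tensor_mat_def)
  fix i j assume "i < dim_row (tensor_mat M (transpose_mat N))" "j < dim_col (tensor_mat M (transpose_mat N))"
  then have ij: "i < m * n" "j < m * n" using carrier_matD[OF tensor_mat_carrier[OF M N']] by auto
  note b = div_less_mult[OF ij(1)] div_less_mult[OF ij(2)] mod_less_mult[OF ij(1)] mod_less_mult[OF ij(2)]
  show "ptranspose_B m n (tensor_mat M N) $$ (i, j) = tensor_mat M (transpose_mat N) $$ (i, j)"
    unfolding ptranspose_B_index[OF ij] tensor_mat_index[OF M N' ij]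
      tensor_mat_index[OF M N mult_add_less_mult[OF b(1,4)] mult_add_less_mult[OF b(2,3)]]
    using b N by simp
qed

lemma pure_proj_idem:
  assumes "\<psi> \<in> carrier_vec d" "\<psi> \<bullet>c \<psi> = 1"
  shows "pure_proj d \<psi> * pure_proj d \<psi> = pure_proj d \<psi>"
proof (rule eq_matI)
  fix i j assume "i < dim_row (pure_proj d \<psi>)" "j < dim_col (pure_proj d \<psi>)"
  then have ij: "i < d" "j < d" by (auto simp: pure_proj_def)
  have 1: "(\<Sum>k<d. \<psi> $ k * cnj (\<psi> $ k)) = 1"
    using assms by (simp add: scalar_prod_def lessThan_atLeast0)
  have "(pure_proj d \<psi> * pure_proj d \<psi>) $$ (i, j) =
      (\<Sum>k<d. \<psi> $ i * cnj (\<psi> $ k) * (\<psi> $ k * cnj (\<psi> $ j)))"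
    unfolding mat_mult_index_sum[OF pure_proj_carrier pure_proj_carrier ij]
    using ij by (intro sum.cong) (auto simp: pure_proj_def)
  also have "\<dots> = \<psi> $ i * cnj (\<psi> $ j) * (\<Sum>k<d. \<psi> $ k * cnj (\<psi> $ k))"
    by (simp add: sum_distrib_left ac_simps)
  finally show "(pure_proj d \<psi> * pure_proj d \<psi>) $$ (i, j) = pure_proj d \<psi> $$ (i, j)"
    using ij by (simp add: 1 pure_proj_def)
qed (auto simp: pure_proj_def)

lemma mat_adjoint_pure_proj [simp]: "mat_adjoint (pure_proj d \<psi>) = pure_proj d \<psi>"
  by (rule eq_matI) (auto simp: mat_adjoint_index pure_proj_def)

text \<open>The projection \<open>P\<close> onto \<open>\<psi>\<close>, its complement
  \<open>Q\<close> and its transpose are all orthogonal projections. They give the lower bound, the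
  upper bound and positivity of the partial transpose, each by
  \<open>psd_tensor_gram\<close>.\<close>

lemma ppt_effect_proj:
  assumes "\<psi> \<in> carrier_vec dB" "\<psi> \<bullet>c \<psi> = 1"
  shows "ppt_effect dA dB (tensor_mat (1\<^sub>m dA) (pure_proj dB \<psi>))"
proof -
  define P where "P = pure_proj dB \<psi>"
  define Q where "Q = 1\<^sub>m dB - P"
  have P: "P \<in> carrier_mat dB dB" by (simp add: P_def)
  have Q: "Q \<in> carrier_mat dB dB" unfolding Q_def by (rule minus_carrier_mat[OF P])
  have PP: "P * P = P" and P': "mat_adjoint P = P"
    using pure_proj_idem[OF assms] by (simp_all add: P_def)
  have Q': "mat_adjoint Q = Q"
    by (rule eq_matI) (auto simp: Q_def P_def mat_adjoint_index pure_proj_def)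
  have "Q * Q = Q"
  proof -
    have "P * Q = 0\<^sub>m dB dB"
      using P by (simp add: Q_def PP mult_minus_distrib_mat[OF P one_carrier_mat P])
    moreover have "Q * Q = Q - P * Q"
      using minus_mult_distrib_mat[OF one_carrier_mat P Q, folded Q_def] left_mult_one_mat[OF Q] by simp
    ultimately show ?thesis using mat_minus_zero[OF Q] by simp
  qed
  then have QQ: "mat_adjoint Q * Q = Q" by (simp add: Q')
  have "psd (dA * dB) (tensor_mat (1\<^sub>m dA) P)" "psd (dA * dB) (tensor_mat (1\<^sub>m dA) Q)"
    using psd_tensor_gram[OF P, of dA] psd_tensor_gram[OF Q, of dA] by (simp_all add: P' PP QQ)
  moreover have "1\<^sub>m (dA * dB) - tensor_mat (1\<^sub>m dA) P = tensor_mat (1\<^sub>m dA) Q"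
    using tensor_mat_diff_right[OF one_carrier_mat one_carrier_mat P]
    by (simp add: Q_def tensor_mat_one)
  moreover have "psd (dA * dB) (ptranspose_B dA dB (tensor_mat (1\<^sub>m dA) P))"
  proof -
    have PT: "transpose_mat P \<in> carrier_mat dB dB" using P by simp
    have "mat_adjoint (transpose_mat P) = transpose_mat P"
      using mat_adjoint_transpose_adjoint[of P] by (simp add: P')
    moreover have "transpose_mat P * transpose_mat P = transpose_mat P"
      using transpose_mult[OF P P] by (simp add: PP)
    ultimately show ?thesis
      using psd_tensor_gram[OF PT, of dA] by (simp add: ptranspose_B_tensor_mat[OF one_carrier_mat P])
  qed
  ultimately show ?thesis
    by (simp add: ppt_effect_def effect_def P_def)
qed

text \<open>Writes the quantity maximized in \<open>F_AB\<close> as an expectation value on the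
  joint system, the form to which \<open>dual_effect\<close> applies. The Kronecker delta of Alice's
  identity collapses the double sum over her indices to the partial trace.\<close>

lemma tr_proj_mult:
  assumes \<psi>: "\<psi> \<in> carrier_vec dB" and M: "M \<in> carrier_mat (dA * dB) (dA * dB)"
  shows "tr (tensor_mat (1\<^sub>m dA) (pure_proj dB \<psi>) * M) = (ptrace_A dA dB M *\<^sub>v \<psi>) \<bullet>c \<psi>"
proof -
  have "tr (tensor_mat (1\<^sub>m dA) (pure_proj dB \<psi>) * M) =
    (\<Sum>a<dA. \<Sum>b<dB. \<Sum>a'<dA. \<Sum>b'<dB. (if a = a' then 1 else 0) *
      (\<psi> $ b * cnj (\<psi> $ b') * M $$ (a' * dB + b', a * dB + b)))"
    unfolding tr_mult_sum[OF tensor_mat_carrier[OF one_carrier_mat pure_proj_carrier] M] sum_lessThan_mult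
    by (intro sum.cong refl)
      (auto simp: tensor_mat_index[OF one_carrier_mat pure_proj_carrier] mult_add_less_mult)
  also have "\<dots> = (\<Sum>a<dA. \<Sum>b<dB. \<Sum>b'<dB. \<psi> $ b * cnj (\<psi> $ b') * M $$ (a * dB + b', a * dB + b))"
  proof (rule sum.cong[OF refl], rule sum.cong[OF refl])
    fix a b assume "a \<in> {..<dA}" "b \<in> {..<dB}"
    have "(\<Sum>a'<dA. \<Sum>b'<dB. (if a = a' then 1 else 0) *
        (\<psi> $ b * cnj (\<psi> $ b') * M $$ (a' * dB + b', a * dB + b))) =
      (\<Sum>a'<dA. if a = a' then \<Sum>b'<dB. \<psi> $ b * cnj (\<psi> $ b') * M $$ (a' * dB + b', a * dB + b) else 0)"
      by (intro sum.cong refl) auto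
    then show "(\<Sum>a'<dA. \<Sum>b'<dB. (if a = a' then 1 else 0) *
        (\<psi> $ b * cnj (\<psi> $ b') * M $$ (a' * dB + b', a * dB + b))) =
      (\<Sum>b'<dB. \<psi> $ b * cnj (\<psi> $ b') * M $$ (a * dB + b', a * dB + b))"
      using \<open>a \<in> {..<dA}\<close> by simp
  qed
  also have "\<dots> = (\<Sum>b'<dB. \<Sum>b<dB. \<Sum>a<dA. \<psi> $ b * cnj (\<psi> $ b') * M $$ (a * dB + b', a * dB + b))"
    by (rule sum_swap_outer)
  also have "\<dots> = (\<Sum>b'<dB. (\<Sum>b<dB. ptrace_A dA dB M $$ (b', b) * \<psi> $ b) * cnj (\<psi> $ b'))"
    by (intro sum.cong refl) (auto simp: ptrace_A_def sum_distrib_left sum_distrib_right ac_simps intro!: sum.cong)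
  also have "\<dots> = (ptrace_A dA dB M *\<^sub>v \<psi>) \<bullet>c \<psi>"
    using \<psi> by (simp add: scalar_prod_def lessThan_atLeast0 ptrace_A_def)
  finally show ?thesis .
qed

lemma tr_proj:
  assumes "\<psi> \<in> carrier_vec dB" "\<psi> \<bullet>c \<psi> = 1"
  shows "tr (tensor_mat (1\<^sub>m dA) (pure_proj dB \<psi>)) = of_nat dA"
proof -
  have "tr (tensor_mat (1\<^sub>m dA) (pure_proj dB \<psi>)) =
      (\<Sum>i<dA * dB. tensor_mat (1\<^sub>m dA) (pure_proj dB \<psi>) $$ (i, i))"
    by (simp add: tr_def tensor_mat_def pure_proj_def)
  also have "\<dots> = (\<Sum>a<dA. \<Sum>b<dB. \<psi> $ b * cnj (\<psi> $ b))"
    unfolding sum_lessThan_mult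
    by (intro sum.cong refl)
      (auto simp: tensor_mat_index[OF one_carrier_mat pure_proj_carrier] mult_add_less_mult)
  also have "(\<Sum>b<dB. \<psi> $ b * cnj (\<psi> $ b)) = 1"
    using assms by (simp add: scalar_prod_def lessThan_atLeast0)
  finally show ?thesis by simp
qed

lemma tr_smult: "tr (c \<cdot>\<^sub>m A) = c * tr A" if "A \<in> carrier_mat n n"
  using that by (simp add: tr_def sum_distrib_left)

text \<open>One \<open>X\<close>, depending only on \<open>\<Lambda>\<close> and
  \<open>\<psi>\<close>, serves all inputs. It may thus be tested on the maximally mixed state,
  which reveals its trace.\<close>

lemma GLOCC_fidelity_feasible:
  assumes pos: "0 < dA" "0 < dB"
    and \<psi>: "\<psi> \<in> carrier_vec dB" "\<psi> \<bullet>c \<psi> = 1"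
    and \<Lambda>: "\<Lambda> \<in> GLOCC dA dB"
  shows "\<exists>X \<in> feasible dA dB. \<forall>\<rho> \<in> carrier_mat (dA * dB) (dA * dB).
    (ptrace_A dA dB (\<Lambda> \<rho>) *\<^sub>v \<psi>) \<bullet>c \<psi> = tr (X * \<rho>)"
proof -
  let ?E = "tensor_mat (1\<^sub>m dA) (pure_proj dB \<psi>)"
  define d where "d = dA * dB"
  have d: "d \<noteq> 0" using pos by (simp add: d_def)
  have E: "?E \<in> carrier_mat d d" by (simp add: d_def)
  obtain X where X: "ppt_effect dA dB X" and dual: "dual_effect d d \<Lambda> ?E X"
    using locc_dual_effect[OF _ ppt_effect_proj[OF \<psi>], of dA dA dB \<Lambda>] \<Lambda> by (auto simp: GLOCC_def d_def)
  have Xc: "X \<in> carrier_mat d d" using X by (simp add: ppt_effect_def effect_carrier d_def)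
  have mm: "tr (A * maximally_mixed d) = tr A / of_nat d" if A: "A \<in> carrier_mat d d" for A
    using tr_smult[OF A] mult_smult_distrib[OF A one_carrier_mat] A
    by (simp add: maximally_mixed_def)
  \<comment> \<open>Here the defining condition of \<open>GLOCC\<close> enters:
    \<open>\<Lambda>\<close> fixes the maximally mixed state, so \<open>?E\<close> and
    \<open>X\<close> have the same expectation in it and hence the same trace.\<close>
  have "tr (?E * maximally_mixed d) = tr (X * maximally_mixed d)"
  proof -
    have "maximally_mixed d \<in> carrier_mat d d" by (simp add: maximally_mixed_def)
    then show ?thesis using dual \<Lambda> by (auto simp: dual_effect_def GLOCC_def d_def)
  qed
  then have "tr X = of_nat dA"
    using d by (simp add: mm[OF E] mm[OF Xc] tr_proj[OF \<psi>])
  moreover have "loewner_le d (0\<^sub>m d d) X" "loewner_le d X (1\<^sub>m d)"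
    using X Xc mat_minus_zero[OF Xc] by (auto simp: loewner_le_def ppt_effect_def effect_def d_def)
  ultimately have "X \<in> feasible dA dB"
    using X by (simp add: feasible_def ppt_effect_def d_def)
  moreover have "(ptrace_A dA dB (\<Lambda> \<rho>) *\<^sub>v \<psi>) \<bullet>c \<psi> = tr (X * \<rho>)"
    if "\<rho> \<in> carrier_mat (dA * dB) (dA * dB)" for \<rho>
    using dual that tr_proj_mult[OF \<psi>(1)] by (auto simp: dual_effect_def d_def)
  ultimately show ?thesis by blast
qed

section \<open>Compactness of the feasible set\<close>

lemma quadratic_form_sum:
  fixes M :: "complex mat"
  assumes "M \<in> carrier_mat d d" "v \<in> carrier_vec d"
  shows "(M *\<^sub>v v) \<bullet>c v = (\<Sum>i<d. \<Sum>j<d. M $$ (i, j) * v $ j * cnj (v $ i))"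
  using assms by (auto simp: scalar_prod_def sum_distrib_right lessThan_atLeast0 intro!: sum.cong)

text \<open>The quadratic form of \<open>X\<close> at the vector \<open>e\<^sub>i + c e\<^sub>j\<close>.\<close>

lemma psd_two_dim:
  assumes X: "psd d X" and ij: "i < d" "j < d"
  shows "0 \<le> X $$ (i, i) + c * X $$ (i, j) + cnj c * X $$ (j, i) + c * cnj c * X $$ (j, j)"
proof -
  define v where "v = vec d (\<lambda>k. (if k = i then 1 else 0) + (if k = j then c else 0))"
  have v: "v \<in> carrier_vec d" by (simp add: v_def)
  have "(\<Sum>a<d. \<Sum>b<d. X $$ (a, b) * v $ b * cnj (v $ a)) =
    (\<Sum>a<d. (\<Sum>b<d. (if b = i then X $$ (a, b) else 0) + (if b = j then X $$ (a, b) * c else 0)) * cnj (v $ a))"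
    unfolding sum_distrib_right by (intro sum.cong refl) (auto simp: v_def algebra_simps)
  also have "\<dots> = (\<Sum>a<d. (X $$ (a, i) + X $$ (a, j) * c) * cnj (v $ a))"
    using ij by (simp add: sum.distrib)
  also have "\<dots> = (\<Sum>a<d. (if a = i then X $$ (a, i) + X $$ (a, j) * c else 0) +
      (if a = j then (X $$ (a, i) + X $$ (a, j) * c) * cnj c else 0))"
    by (intro sum.cong refl) (auto simp: v_def algebra_simps)
  also have "\<dots> = X $$ (i, i) + c * X $$ (i, j) + cnj c * X $$ (j, i) + c * cnj c * X $$ (j, j)"
    using ij by (simp add: sum.distrib algebra_simps)
  finally show ?thesis
    using X v quadratic_form_sum[OF psd_carrier[OF X] v] by (auto simp: psd_def)
qed

lemma psd_diag: "psd d X \<Longrightarrow> i < d \<Longrightarrow> 0 \<le> X $$ (i, i)"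
  using psd_two_dim[of d X i i 0] by simp

text \<open>Positivity of \<open>1 - X\<close> bounds the diagonal by 1, and positivity of
  \<open>X\<close> controls the other entries by the diagonal. The constant 2 is not sharp;
  compactness asks only for some bound.\<close>

lemma effect_entry_bound:
  assumes X: "effect d X" and ij: "i < d" "j < d"
  shows "\<bar>Re (X $$ (i, j))\<bar> \<le> 2" "\<bar>Im (X $$ (i, j))\<bar> \<le> 2"
proof -
  have p: "psd d X" and q: "psd d (1\<^sub>m d - X)" using X by (auto simp: effect_def)
  have le1: "Re (X $$ (k, k)) \<le> 1" if "k < d" for k
    using psd_diag[OF q that] that carrier_matD[OF psd_carrier[OF p]] by (simp add: less_eq_complex_def)
  note 1 = le1[OF ij(1)] le1[OF ij(2)]
  \<comment> \<open>The values 1 and -1 of \<open>c\<close> bound the real part of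
    \<open>X $$ (i, j) + X $$ (j, i)\<close>, and \<i> and -\<i> bound the imaginary part of the
    difference. The vanishing imaginary parts of the four forms make the two entries
    conjugate.\<close>
  note t = psd_two_dim[OF p ij, of 1] psd_two_dim[OF p ij, of "-1"]
    psd_two_dim[OF p ij, of \<i>] psd_two_dim[OF p ij, of "-\<i>"]
  show "\<bar>Re (X $$ (i, j))\<bar> \<le> 2" "\<bar>Im (X $$ (i, j))\<bar> \<le> 2"
    using t 1 by (auto simp: less_eq_complex_def)
qed

text \<open>Each vector \<open>v\<close> contributes a closed condition, since the quadratic form
  depends continuously on the entries; the set is the intersection over all \<open>v\<close>.
  Working with a family \<open>M f\<close> lets continuity be stated entry by entry.\<close>

lemma closed_psd:
  fixes M :: "'a :: topological_space \<Rightarrow> complex mat"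
  assumes M: "\<And>f. M f \<in> carrier_mat d d"
    and cont: "\<And>i j. i < d \<Longrightarrow> j < d \<Longrightarrow> continuous_on UNIV (\<lambda>f. M f $$ (i, j))"
  shows "closed {f. psd d (M f)}"
proof -
  have psd_iff: "psd d (M f) \<longleftrightarrow>
      (\<forall>v \<in> carrier_vec d. 0 \<le> (\<Sum>i<d. \<Sum>j<d. M f $$ (i, j) * v $ j * cnj (v $ i)))" for f
    unfolding psd_def using M quadratic_form_sum[OF M] by simp
  have "{f. psd d (M f)} = (\<Inter>v \<in> carrier_vec d.
      {f. 0 \<le> Re (\<Sum>i<d. \<Sum>j<d. M f $$ (i, j) * v $ j * cnj (v $ i)) \<and>
          Im (\<Sum>i<d. \<Sum>j<d. M f $$ (i, j) * v $ j * cnj (v $ i)) = 0})"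
    using psd_iff by (auto simp: less_eq_complex_def simp del: Re_sum Im_sum)
  also have "closed \<dots>"
    by (intro closed_INT ballI closed_Collect_conj closed_Collect_le closed_Collect_eq
        continuous_intros cont) auto
  finally show ?thesis .
qed

lemma feasible_iff:
  "X \<in> feasible dA dB \<longleftrightarrow> ppt_effect dA dB X \<and> tr X = of_nat dA"
proof (cases "X \<in> carrier_mat (dA * dB) (dA * dB)")
  case True
  then show ?thesis
    by (auto simp: feasible_def ppt_effect_def effect_def loewner_le_def mat_minus_zero)
next
  case False
  then show ?thesis
    by (auto simp: feasible_def ppt_effect_def effect_def loewner_le_def dest: psd_carrier)
qed

text \<open>Matrices are parametrized by functions on index pairs with the product topology. There
  the feasible matrices are the image of a compact set, on which the objective is
  continuous.\<close>

lemma feasible_attains_max: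
  assumes ne: "feasible dA dB \<noteq> {}" and \<rho>: "\<rho> \<in> carrier_mat (dA * dB) (dA * dB)"
  shows "\<exists>X \<in> feasible dA dB. \<forall>Y \<in> feasible dA dB. Re (tr (Y * \<rho>)) \<le> Re (tr (X * \<rho>))"
proof -
  define d where "d = dA * dB"
  define M where "M = (\<lambda>f :: nat \<times> nat \<Rightarrow> complex. mat d d f)"
  define K where "K = (\<lambda>(x, y). Complex x y) ` ({-2..2} \<times> {-2..2})"
  \<comment> \<open>All coordinates are confined to the square \<open>K\<close>, including those
    outside the \<open>d\<close> by \<open>d\<close> block that \<open>M\<close> ignores; this makes
    the full product compact.\<close>
  define S where "S = {f. \<forall>p. f p \<in> K} \<inter> {f. M f \<in> feasible dA dB}"
  have M: "M f \<in> carrier_mat d d" and M_index: "i < d \<Longrightarrow> j < d \<Longrightarrow> M f $$ (i, j) = f (i, j)" for f i j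
    by (simp_all add: M_def)
  have "compact K"
    unfolding K_def case_prod_unfold
    by (intro compact_continuous_image compact_Times continuous_intros) auto
  \<comment> \<open>Tychonoff's theorem.\<close>
  then have "compact (PiE UNIV (\<lambda>_ :: nat \<times> nat. K))"
    using compactin_PiE[of "\<lambda>_ :: nat \<times> nat. euclidean" UNIV "\<lambda>_. K"]
    by (simp add: euclidean_product_topology)
  then have cpt: "compact {f :: nat \<times> nat \<Rightarrow> complex. \<forall>p. f p \<in> K}"
    by (simp add: PiE_def Pi_def)
  have cont: "continuous_on UNIV (\<lambda>f :: nat \<times> nat \<Rightarrow> complex. f p)" for p
    by (rule continuous_on_product_coordinates)
  have "closed {f. psd d (M f)}"
    by (intro closed_psd M) (simp add: M_index cont)
  moreover have "closed {f. psd d (1\<^sub>m d - M f)}"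
  proof (rule closed_psd)
    show "1\<^sub>m d - M f \<in> carrier_mat d d" for f by (rule minus_carrier_mat[OF M])
    show "continuous_on UNIV (\<lambda>f. (1\<^sub>m d - M f) $$ (i, j))" if "i < d" "j < d" for i j
      using that carrier_matD[OF M]
      by (cases "i = j") (auto simp: M_index intro!: continuous_intros cont)
  qed
  \<comment> \<open>Partial transposition only permutes entries, so every entry is again a
    coordinate of \<open>f\<close>.\<close>
  moreover have "closed {f. psd d (ptranspose_B dA dB (M f))}"
  proof (rule closed_psd)
    show "ptranspose_B dA dB (M f) \<in> carrier_mat d d" for f by (simp add: d_def)
    show "continuous_on UNIV (\<lambda>f. ptranspose_B dA dB (M f) $$ (i, j))" if "i < d" "j < d" for i j
    proof -
      note ij = that[unfolded d_def]
      note b = div_less_mult[OF ij(1)] div_less_mult[OF ij(2)] mod_less_mult[OF ij(1)] mod_less_mult[OF ij(2)]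
      show ?thesis
        unfolding ptranspose_B_index[OF ij]
        using mult_add_less_mult[OF b(1,4)] mult_add_less_mult[OF b(2,3)]
        by (simp add: M_index d_def cont)
    qed
  qed
  moreover have "closed {f. tr (M f) = of_nat dA}"
  proof -
    have "tr (M f) = (\<Sum>i<d. f (i, i))" for f by (simp add: tr_def M_def)
    then show ?thesis by simp (intro closed_Collect_eq continuous_intros cont)
  qed
  ultimately have "closed {f. M f \<in> feasible dA dB}"
    unfolding feasible_iff ppt_effect_def effect_def d_def
    by (intro closed_Collect_conj)
  then have "compact S"
    unfolding S_def using cpt by (rule compact_Int_closed[rotated])
  have S_onto: "\<exists>f\<in>S. M f = Y" if Y: "Y \<in> feasible dA dB" for Y
  proof -
    have eff: "effect d Y" using Y by (simp add: feasible_iff ppt_effect_def d_def)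
    \<comment> \<open>The default 0 outside the block lies in \<open>K\<close>, as membership in
      \<open>S\<close> demands.\<close>
    define f where "f = (\<lambda>p. if fst p < d \<and> snd p < d then Y $$ p else 0)"
    have "M f = Y"
      using effect_carrier[OF eff] by (intro eq_matI) (auto simp: M_def f_def)
    moreover have "f p \<in> K" for p
    proof -
      have "\<bar>Re (f p)\<bar> \<le> 2 \<and> \<bar>Im (f p)\<bar> \<le> 2"
        using effect_entry_bound[OF eff, of "fst p" "snd p"] by (auto simp: f_def)
      then show ?thesis
        unfolding K_def by (intro image_eqI[of _ _ "(Re (f p), Im (f p))"]) auto
    qed
    ultimately show ?thesis using Y by (auto simp: S_def)
  qed
  have "continuous_on S (\<lambda>f. Re (tr (M f * \<rho>)))"
  proof -
    have "tr (M f * \<rho>) = (\<Sum>i<d. \<Sum>j<d. f (i, j) * \<rho> $$ (j, i))" for f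
      using tr_mult_sum[OF M \<rho>[folded d_def]] by (simp add: M_index)
    then have "continuous_on UNIV (\<lambda>f. Re (tr (M f * \<rho>)))"
      by simp (intro continuous_intros cont)
    then show ?thesis by (rule continuous_on_subset) simp
  qed
  moreover have "S \<noteq> {}" using ne S_onto by blast
  ultimately obtain f where f: "f \<in> S" "\<forall>g\<in>S. Re (tr (M g * \<rho>)) \<le> Re (tr (M f * \<rho>))"
    using continuous_attains_sup[OF \<open>compact S\<close>] by blast
  show ?thesis
  proof (intro bexI[of _ "M f"] ballI)
    show "M f \<in> feasible dA dB" using f(1) by (simp add: S_def)
    show "Re (tr (Y * \<rho>)) \<le> Re (tr (M f * \<rho>))" if "Y \<in> feasible dA dB" for Y
      using S_onto[OF that] f(2) by blast
  qed
qed

section \<open>The bound on \<open>F_AB\<close>\<close>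

theorem proposition3:
  fixes dA dB :: nat and \<psi> :: "complex vec" and \<rho> :: "complex mat"
  assumes "0 < dA" and "0 < dB"
    and "\<psi> \<in> carrier_vec dB" and "\<psi> \<bullet>c \<psi> = 1"
    and "quantum_state (dA * dB) \<rho>"
  shows "\<exists>X \<in> feasible dA dB.
    (\<forall>Y \<in> feasible dA dB. Re (tr (Y * \<rho>)) \<le> Re (tr (X * \<rho>))) \<and>
    F_AB dA dB \<psi> \<rho> \<le> Re (tr (X * \<rho>))"
proof -
  have \<rho>: "\<rho> \<in> carrier_mat (dA * dB) (dA * dB)"
    using assms(5) by (simp add: quantum_state_def psd_carrier)
  have dual: "\<exists>X \<in> feasible dA dB. (ptrace_A dA dB (\<Lambda> \<rho>) *\<^sub>v \<psi>) \<bullet>c \<psi> = tr (X * \<rho>)"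
    if "\<Lambda> \<in> GLOCC dA dB" for \<Lambda>
    using GLOCC_fidelity_feasible[OF assms(1-4) that] \<rho> by blast
  \<comment> \<open>The identity protocol serves twice: it makes the supremum one over a nonempty
    set, and its dual effect shows that \<open>feasible\<close> is nonempty.\<close>
  have id: "(\<lambda>\<rho>. \<rho>) \<in> GLOCC dA dB"
    by (simp add: GLOCC_def locc.stop)
  obtain X where X: "X \<in> feasible dA dB"
    and max: "\<And>Y. Y \<in> feasible dA dB \<Longrightarrow> Re (tr (Y * \<rho>)) \<le> Re (tr (X * \<rho>))"
    using feasible_attains_max[OF _ \<rho>] dual[OF id] by blast
  have "F_AB dA dB \<psi> \<rho> \<le> Re (tr (X * \<rho>))"
    unfolding F_AB_def
  proof (rule cSUP_least)
    show "GLOCC dA dB \<noteq> {}" using id by blast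
    show "Re ((ptrace_A dA dB (\<Lambda> \<rho>) *\<^sub>v \<psi>) \<bullet>c \<psi>) \<le> Re (tr (X * \<rho>))" if "\<Lambda> \<in> GLOCC dA dB" for \<Lambda>
      using dual[OF that] max by auto
  qed
  with X max show ?thesis by blast
qed

end
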